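(* Let $\gamma$ be an arbitrary root of the polynomial $\mathcal{T}(x)=x^3-2x^2-x+1$, and let $q$ be a root of unity of degree $14$, with $q^2$ a primitive root of unity of degree $7$, such that $[3]=q^2+1+q^{-2}=\gamma$. Then the Turaev--Viro type invariant $TH_4$ of order $4$, which coincides with the homologically trivial part $TV_{7,0}$ of the Turaev--Viro invariant of order $7$, is given by the following values of the weights $w_i'$, $i\in\{0,1,2\}$, and $6j$-symbols $\left|\begin{array}{lll} i & j & k\\ l & m & n\end{array}\right|'$, $i,j,k,l,m,n\in\{0,1,2\}$: $$w_0'=1,\qquad w_1'=\gamma,\qquad w_2'=\frac{\gamma}{\gamma-1},$$ and $$\left|\begin{array}{lll}0&0&0\\0&0&0\end{array}\right|'=1,\quad \left|\begin{array}{lll}0&0&0\\1&1&1\end{array}\right|'=-\frac{1}{\sqrt{\gamma}},\quad \left|\begin{array}{lll}0&0&0\\2&2&2\end{array}\right|'=\frac{\sqrt{\gamma-1}}{\sqrt{\gamma}},$$ $$\left|\begin{array}{lll}0&1&1\\0&1&1\end{array}\right|'=\frac1\gamma,\quad \left|\begin{array}{lll}0&1&1\\1&1&1\end{array}\right|'=\frac1\gamma,\quad \left|\begin{array}{lll}0&1&1\\1&2&2\end{array}\right|'=-\frac{\sqrt{\gamma-1}}{\gamma},$$ $$\left|\begin{array}{lll}0&1&1\\2&1&1\end{array}\right|'=\frac1\gamma,\quad \left|\begin{array}{lll}0&1&1\\2&2&2\end{array}\right|'=-\frac{\sqrt{\gamma-1}}{\gamma},$$ $$\left|\begin{array}{lll}0&2&2\\0&2&2\end{array}\right|'=\frac{\gamma-1}{\gamma},\quad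 \left|\begin{array}{lll}0&2&2\\1&2&2\end{array}\right|'=\frac{\gamma-1}{\gamma},$$ $$\left|\begin{array}{lll}1&1&1\\1&1&1\end{array}\right|'=\frac{1}{\gamma^3},\quad \left|\begin{array}{lll}1&1&1\\1&1&2\end{array}\right|'=-\frac{1}{\gamma(\gamma-1)},\quad \left|\begin{array}{lll}1&1&1\\1&2&2\end{array}\right|'=-\frac{1}{\gamma\sqrt{\gamma}},$$ $$\left|\begin{array}{lll}1&1&1\\2&2&2\end{array}\right|'=\frac{\gamma-1}{\gamma\sqrt{\gamma}},\quad \left|\begin{array}{lll}1&1&2\\1&1&2\end{array}\right|'=\frac{1}{\gamma^2},\quad \left|\begin{array}{lll}1&1&2\\1&2&2\end{array}\right|'=\frac1\gamma,$$ $$\left|\begin{array}{lll}1&2&2\\1&2&2\end{array}\right|'=-\frac{\gamma-1}{\gamma^2}.$$ All other $6j$-symbols, i.e. those not obtained from a listed one by a tetrahedral symmetry, are zero.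
   Context: Quantum integers. Let $q$ be a root of unity of degree $14$ such that $q^2$ is a primitive root of unity of degree $7$. Put $[n]=\frac{q^n-q^{-n}}{q-q^{-1}}$ (a real number), $[n]!=[n][n-1]\cdots[1]$, $[0]!=1$. Data of the Turaev--Viro invariant $TV_7$. The colour set is $C_7=\{0,1,2,3,4,5\}$. The colour weights are $w_i=(-1)^i[i+1]$, $i\in C_7$. Write $\widehat{x}=x/2$. A triple $(x,y,z)\in C_7^3$ is admissible if $x+y\ge z$, $y+z\ge x$, $z+x\ge y$, $x+y+z$ is even, and $x+y+z\le 10$. The $6j$-symbol $\left|\begin{array}{lll} i & j & k\\ l & m & n\end{array}\right|$ is $0$ if at least one of $(i,j,k)$, $(k,l,m)$, $(m,n,i)$, $(j,l,n)$ is not admissible; otherwise $$\left|\begin{array}{lll} i & j & k\\ l & m & n\end{array}\right|=\sum_{z=\alpha}^{\beta}\frac{(-1)^z\,[z+1]!\,A}{B(z)\,C(z)},$$ where, with $\mathbf{i}$ the imaginary unit, $A=\mathbf{i}^{\,i+j+k+l+m+n}\,\Delta(i,j,k)\Delta(i,m,n)\Delta(j,l,n)\Delta(k,l,m)$, $B(z)=[z-\widehat i-\widehat j-\widehat k]!\,[z-\widehat i-\widehat m-\widehat n]!\,[z-\widehat j-\widehat l-\widehat n]!\,[z-\widehat k-\widehat l-\widehat m]!$, $C(z)=[\widehat i+\widehat j+\widehat l+\widehat m-z]!\,[\widehat i+\widehat k+\widehat l+\widehat n-z]!\,[\widehat j+\widehat k+\widehat m+\widehat n-z]!$, $$\Delta(i,j,k)=\sqrt{\frac{[\widehat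 i+\widehat j-\widehat k]!\,[\widehat j+\widehat k-\widehat i]!\,[\widehat k+\widehat i-\widehat j]!}{[\widehat i+\widehat j+\widehat k+1]!}},$$ $\alpha=\max(\widehat i+\widehat j+\widehat k,\ \widehat i+\widehat m+\widehat n,\ \widehat j+\widehat l+\widehat n,\ \widehat k+\widehat l+\widehat m)$, $\beta=\min(\widehat i+\widehat j+\widehat l+\widehat m,\ \widehat i+\widehat k+\widehat l+\widehat n,\ \widehat j+\widehat k+\widehat m+\widehat n)$. Homologically trivial part. The homologically trivial part $TV_{7,0}$ is the part of $TV_7$ using only even colours. It is the Turaev--Viro type invariant $TH_4$ of order $4$, with colour set $\{0,1,2\}$, whose data are $w_i'=w_{2i}$ and $\left|\begin{array}{lll} i & j & k\\ l & m & n\end{array}\right|'=\left|\begin{array}{lll} 2i & 2j & 2k\\ 2l & 2m & 2n\end{array}\right|$ for $i,j,k,l,m,n\in\{0,1,2\}$. Saying that $TH_4$ is "given by" certain values of weights and $6j$-symbols means that these data take those values. Square roots. The square roots are complex. $\sqrt{\gamma}$ and $\sqrt{\gamma-1}$ denote fixed square roots of $\gamma$ and $\gamma-1$, the same in all formulas. In the definition of $\Delta$, one square root is chosen for each unordered admissible triple (with $\Delta(0,0,0)=1$). The value of the invariant does not depend on these choices of sign, and the listed values are asserted for a suitable choice of the square roots defining $\Delta$. Tetrahedral symmetries. These are the transformations of $\left|\begin{array}{lll} i & j & k\\ l & m & n\end{array}\right|'$ generated by permutations of the three columns and by simultaneous exchange of the upper and lower entries in any two columns; $6j$-symbols related by them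 are equal, and the list gives one representative from each class of nonzero symbols. *)

theory Defs
  imports Complex_Main "HOL-Computational_Algebra.Polynomial"
begin

definition primitive_root_of_unity :: "nat \<Rightarrow> complex \<Rightarrow> bool" where
  "primitive_root_of_unity n z \<longleftrightarrow> n > 0 \<and> z ^ n = 1 \<and> (\<forall>k. 0 < k \<and> k < n \<longrightarrow> z ^ k \<noteq> 1)"

definition qint :: "complex \<Rightarrow> nat \<Rightarrow> complex" where
  "qint q n = (q ^ n - 1 / q ^ n) / (q - 1 / q)"

definition qfact :: "complex \<Rightarrow> nat \<Rightarrow> complex" where
  "qfact q n = (\<Prod>k=1..n. qint q k)"

definition TV7_colours :: "nat set" where
  "TV7_colours = {0..5}"

definition TV7_weight :: "complex \<Rightarrow> nat \<Rightarrow> complex" where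
  "TV7_weight q i = (- 1) ^ i * qint q (i + 1)"

definition admissible :: "nat \<Rightarrow> nat \<Rightarrow> nat \<Rightarrow> bool" where
  "admissible x y z \<longleftrightarrow> x \<in> TV7_colours \<and> y \<in> TV7_colours \<and> z \<in> TV7_colours \<and>
     x + y \<ge> z \<and> y + z \<ge> x \<and> z + x \<ge> y \<and> even (x + y + z) \<and> x + y + z \<le> 10"

text \<open>
  Halved colours only occur in sums that are non-negative integers whenever the triples
  involved are admissible, so truncated subtraction and \<open>div 2\<close> on natural numbers are
  exact wherever the following definitions are used.
\<close>

definition Delta_radicand :: "complex \<Rightarrow> nat \<Rightarrow> nat \<Rightarrow> nat \<Rightarrow> complex" where
  "Delta_radicand q i j k =
     qfact q ((i + j - k) div 2) * qfact q ((j + k - i) div 2) * qfact q ((k + i - j) div 2) /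
     qfact q ((i + j + k) div 2 + 1)"

text \<open>
  The square roots in \<open>\<Delta>\<close> are a parameter \<open>D\<close>: one complex square root for each
  unordered admissible triple. The two symmetry conditions generate all permutations.
\<close>

definition Delta_choice :: "complex \<Rightarrow> (nat \<Rightarrow> nat \<Rightarrow> nat \<Rightarrow> complex) \<Rightarrow> bool" where
  "Delta_choice q D \<longleftrightarrow>
     (\<forall>i j k. admissible i j k \<longrightarrow>
        (D i j k)\<^sup>2 = Delta_radicand q i j k \<and> D i j k = D j i k \<and> D i j k = D i k j) \<and>
     D 0 0 0 = 1"

text \<open>A symbol is given by its upper and its lower row.\<close>

type_synonym symbol = "(nat \<times> nat \<times> nat) \<times> (nat \<times> nat \<times> nat)"

fun TV7_sixj :: "complex \<Rightarrow> (nat \<Rightarrow> nat \<Rightarrow> nat \<Rightarrow> complex) \<Rightarrow> symbol \<Rightarrow> complex" where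
  "TV7_sixj q D ((i, j, k), (l, m, n)) =
    (if admissible i j k \<and> admissible k l m \<and> admissible m n i \<and> admissible j l n then
       (let
          t1 = (i + j + k) div 2; t2 = (i + m + n) div 2;
          t3 = (j + l + n) div 2; t4 = (k + l + m) div 2;
          u1 = (i + j + l + m) div 2; u2 = (i + k + l + n) div 2; u3 = (j + k + m + n) div 2;
          \<alpha> = max (max t1 t2) (max t3 t4);
          \<beta> = min u1 (min u2 u3);
          A = \<i> ^ (i + j + k + l + m + n) * D i j k * D i m n * D j l n * D k l m;
          B = (\<lambda>z. qfact q (z - t1) * qfact q (z - t2) * qfact q (z - t3) * qfact q (z - t4));
          C = (\<lambda>z. qfact q (u1 - z) * qfact q (u2 - z) * qfact q (u3 - z))
        in \<Sum>z=\<alpha>..\<beta>. (- 1) ^ z * qfact q (z + 1) * A / (B z * C z))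
     else 0)"

text \<open>
  The homologically trivial part only uses the even colours \<open>0, 2, 4\<close>, which are
  relabelled as \<open>0, 1, 2\<close>.
\<close>

definition TH4_colours :: "nat set" where
  "TH4_colours = {0, 1, 2}"

lemma TH4_colours_even: "bij_betw (\<lambda>i. 2 * i) TH4_colours {c \<in> TV7_colours. even c}"
proof -
  have "{c \<in> TV7_colours. even c} = {0, 2, 4}"
  proof
    show "{c \<in> TV7_colours. even c} \<subseteq> {0, 2, 4}"
    proof
      fix c assume "c \<in> {c \<in> TV7_colours. even c}"
      then have "c \<le> 5" "even c" by (simp_all add: TV7_colours_def)
      then have "c = 0 \<or> c = 2 \<or> c = 4" by presburger
      then show "c \<in> {0, 2, 4}" by simp
    qed
  qed (auto simp: TV7_colours_def)
  then show ?thesis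
    by (auto simp: bij_betw_def TH4_colours_def)
qed

definition TH4_weight :: "complex \<Rightarrow> nat \<Rightarrow> complex" where
  "TH4_weight q i = TV7_weight q (2 * i)"

fun TH4_sixj :: "complex \<Rightarrow> (nat \<Rightarrow> nat \<Rightarrow> nat \<Rightarrow> complex) \<Rightarrow> symbol \<Rightarrow> complex" where
  "TH4_sixj q D ((i, j, k), (l, m, n)) =
     TV7_sixj q D ((2 * i, 2 * j, 2 * k), (2 * l, 2 * m, 2 * n))"

definition TH4_symbols :: "symbol set" where
  "TH4_symbols = (TH4_colours \<times> TH4_colours \<times> TH4_colours) \<times>
                 (TH4_colours \<times> TH4_colours \<times> TH4_colours)"

text \<open>
  The transpositions of neighbouring columns generate all column permutations. All generators
  are involutions, so closing under composition yields the orbits of the generated group.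
\<close>

inductive tetrahedral :: "symbol \<Rightarrow> symbol \<Rightarrow> bool" where
  refl: "tetrahedral S S"
| swap12: "tetrahedral S ((i, j, k), (l, m, n)) \<Longrightarrow> tetrahedral S ((j, i, k), (m, l, n))"
| swap23: "tetrahedral S ((i, j, k), (l, m, n)) \<Longrightarrow> tetrahedral S ((i, k, j), (l, n, m))"
| exchange12: "tetrahedral S ((i, j, k), (l, m, n)) \<Longrightarrow> tetrahedral S ((l, m, k), (i, j, n))"
| exchange13: "tetrahedral S ((i, j, k), (l, m, n)) \<Longrightarrow> tetrahedral S ((l, j, n), (i, m, k))"
| exchange23: "tetrahedral S ((i, j, k), (l, m, n)) \<Longrightarrow> tetrahedral S ((i, m, n), (l, j, k))"

text \<open>
  In the table below, \<open>r\<close> and \<open>s\<close> stand for the chosen square roots of \<open>\<gamma>\<close>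
  and \<open>\<gamma> - 1\<close>.
\<close>

definition TH4_table :: "complex \<Rightarrow> complex \<Rightarrow> complex \<Rightarrow> (symbol \<times> complex) set" where
  "TH4_table \<gamma> r s = {
     (((0,0,0),(0,0,0)), 1),
     (((0,0,0),(1,1,1)), - (1 / r)),
     (((0,0,0),(2,2,2)), s / r),
     (((0,1,1),(0,1,1)), 1 / \<gamma>),
     (((0,1,1),(1,1,1)), 1 / \<gamma>),
     (((0,1,1),(1,2,2)), - (s / \<gamma>)),
     (((0,1,1),(2,1,1)), 1 / \<gamma>),
     (((0,1,1),(2,2,2)), - (s / \<gamma>)),
     (((0,2,2),(0,2,2)), (\<gamma> - 1) / \<gamma>),
     (((0,2,2),(1,2,2)), (\<gamma> - 1) / \<gamma>),
     (((1,1,1),(1,1,1)), 1 / \<gamma> ^ 3),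
     (((1,1,1),(1,1,2)), - (1 / (\<gamma> * (\<gamma> - 1)))),
     (((1,1,1),(1,2,2)), - (1 / (\<gamma> * r))),
     (((1,1,1),(2,2,2)), (\<gamma> - 1) / (\<gamma> * r)),
     (((1,1,2),(1,1,2)), 1 / \<gamma>\<^sup>2),
     (((1,1,2),(1,2,2)), 1 / \<gamma>),
     (((1,2,2),(1,2,2)), - ((\<gamma> - 1) / \<gamma>\<^sup>2))}"

definition poly_T :: "complex poly" where
  "poly_T = [:1, - 1, - 2, 1:]"

lemma poly_poly_T: "poly poly_T x = x ^ 3 - 2 * x\<^sup>2 - x + 1"
  by (simp add: poly_T_def algebra_simps power2_eq_square power3_eq_cube)

text \<open>Every root of \<open>poly_T\<close> is of the form \<open>[3]\<close> for a suitable \<open>q\<close>.\<close>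

lemma exists_q:
  assumes "poly poly_T \<gamma> = 0"
  shows "\<exists>q. q ^ 14 = 1 \<and> primitive_root_of_unity 7 (q\<^sup>2) \<and> qint q 3 = \<gamma>"
proof -
  define e where "e = csqrt ((1 - \<gamma>)\<^sup>2 - 4)"
  define u where "u = (\<gamma> - 1 + e) / 2"
  have e2: "e\<^sup>2 = (1 - \<gamma>)\<^sup>2 - 4" by (simp add: e_def)
  have "4 * (u\<^sup>2 + (1 - \<gamma>) * u + 1) = e\<^sup>2 - ((1 - \<gamma>)\<^sup>2 - 4)"
    by (simp add: u_def power2_eq_square field_simps)
  then have u: "u\<^sup>2 + (1 - \<gamma>) * u + 1 = 0"
    unfolding e2 by (metis diff_self mult_eq_0_iff zero_neq_numeral)
  then have u0: "u \<noteq> 0" by auto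
  have g: "\<gamma> * u = u\<^sup>2 + u + 1"
    using u by (simp add: algebra_simps)
  have "u ^ 3 * (\<gamma> ^ 3 - 2 * \<gamma>\<^sup>2 - \<gamma> + 1) = 
        (\<gamma> * u) ^ 3 - 2 * (\<gamma> * u)\<^sup>2 * u - (\<gamma> * u) * u\<^sup>2 + u ^ 3"
    by (simp add: algebra_simps power2_eq_square power3_eq_cube)
  also have "\<dots> = u ^ 6 + u ^ 5 + u ^ 4 + u ^ 3 + u\<^sup>2 + u + 1"
    unfolding g by (simp add: algebra_simps eval_nat_numeral)
  finally have s: "u ^ 6 + u ^ 5 + u ^ 4 + u ^ 3 + u\<^sup>2 + u + 1 = 0"
    using assms by (simp add: poly_poly_T)
  have "u ^ 7 - 1 = (u - 1) * (u ^ 6 + u ^ 5 + u ^ 4 + u ^ 3 + u\<^sup>2 + u + 1)"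
    by (simp add: algebra_simps eval_nat_numeral)
  then have u7: "u ^ 7 = 1" using s by simp
  have u1: "u \<noteq> 1" using s by auto
  have prim: "u ^ k \<noteq> 1" if k: "0 < k" "k < 7" for k :: nat
  proof
    assume uk: "u ^ k = 1"
    have "k = 1 \<or> k = 2 \<or> k = 3 \<or> k = 4 \<or> k = 5 \<or> k = 6" using k by linarith
    then have "\<exists>x y. k * x = 7 * y + 1"
      by (elim disjE; hypsubst; presburger)
    then obtain x y where "k * x = 7 * y + 1" by blast
    then have "u ^ (k * x) = u ^ (7 * y + 1)" by simp
    then show False using uk u7 u1 by (simp add: power_mult power_add)
  qed
  define q where "q = csqrt u"
  have q2: "q\<^sup>2 = u" by (simp add: q_def)
  have q0: "q \<noteq> 0" using q2 u0 by auto
  have "q ^ 14 = (q\<^sup>2) ^ 7" by (simp flip: power_mult)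
  then have q14: "q ^ 14 = 1" using q2 u7 by simp
  have nz: "q\<^sup>2 - 1 \<noteq> 0" using q2 u1 by simp
  have "qint q 3 = (q ^ 6 - 1) / (q\<^sup>2 * (q\<^sup>2 - 1))"
    using q0 nz by (simp add: qint_def field_simps eval_nat_numeral)
  also have "q ^ 6 - 1 = (q\<^sup>2 - 1) * (\<gamma> * u)"
    unfolding g by (simp flip: q2 add: algebra_simps eval_nat_numeral)
  finally have "qint q 3 = \<gamma>"
    using nz u0 q2 by simp
  then show ?thesis
    using q14 q2 u7 prim by (auto simp: primitive_root_of_unity_def)
qed

end

theory Submission
  imports Defs "HOL-Library.Product_Lexorder"
begin

text \<open>
  Everything is expressed through the two roots \<open>r\<close> and \<open>s\<close>, where \<open>\<gamma> = r\<^sup>2\<close> and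
  \<open>\<gamma> - 1 = s\<^sup>2\<close>; both are non-zero because 0 and 1 are not roots of the cubic. Since
  \<open>q\<^sup>1\<^sup>4 = 1\<close>, the quantum integers obey the reflection
  \<open>[7 - n] = e [n]\<close> with \<open>e = - q\<^sup>7 = \<plusminus>1\<close>; together with \<open>[2][3] = [2] + [4]\<close> this gives
  \<open>[2] = e \<gamma> / (\<gamma> - 1)\<close>, so the quantum factorials \<open>[n]!\<close> with \<open>n \<le> 6\<close> are,
  up to the sign \<open>e\<close>, Laurent monomials in \<open>r\<close> and \<open>s\<close> (\<open>qfact_values\<close>).
  In particular \<open>[5] = e [2]\<close> is the weight
  \<open>\<gamma> / (\<gamma> - 1)\<close>.

  For the even colours the radicands of \<open>\<Delta>\<close> are squares of such monomials in \<open>r\<close> and \<open>s\<close>, and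
  these monomials, taken with positive sign throughout, are the square roots that produce the listed
  signs (\<open>root_choice\<close>). As \<open>[7]! = 0\<close>, each Racah sum in the table collapses to a monomial
  as well, except for the symbol all of whose entries are 1: it has two non-zero terms and equals
  \<open>1 / \<gamma>\<^sup>2 - (\<gamma> - 1) / \<gamma>\<^sup>3\<close> (\<open>TH4_table_values\<close>). The sign \<open>e\<close> cancels everywhere.

  Tetrahedral invariance (\<open>TH4_sixj_tetrahedral\<close>) holds because a symmetry only permutes the
  four faces and the three quadrilaterals of the tetrahedron on which the Racah sum depends.

  For the vanishing of the remaining symbols the point is that the table consists of canonical
  forms: a symbol with admissible faces that is lexicographically no larger than its images under
  the five generators of the symmetries is in the table (\<open>minimal_admissible_in_table\<close>). A
  non-zero symbol has admissible faces, and so does the least element of its class, which is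
  therefore listed.
\<close>

section \<open>Quantum integers at a fourteenth root of unity\<close>

lemma qint_1:
  assumes "q \<noteq> 0" and "q\<^sup>2 \<noteq> 1"
  shows "qint q 1 = 1"
  using assms by (simp add: qint_def field_simps power2_eq_square)

lemma qint_3:
  assumes "q \<noteq> 0" and "q\<^sup>2 \<noteq> 1"
  shows "qint q 3 = q\<^sup>2 + 1 + 1 / q\<^sup>2"
  using assms by (simp add: qint_def field_simps eval_nat_numeral)

lemma qint_2_mult_qint_3:
  assumes "q \<noteq> 0" and "q\<^sup>2 \<noteq> 1"
  shows "qint q 2 * qint q 3 = qint q 2 + qint q 4"
proof -
  have "qint q 2 = q + 1 / q"
    using assms by (simp add: qint_def field_simps eval_nat_numeral)
  moreover have "(q + 1 / q) * (q ^ 3 - 1 / q ^ 3) = (q ^ 2 - 1 / q ^ 2) + (q ^ 4 - 1 / q ^ 4)"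
    using assms by (simp add: field_simps eval_nat_numeral)
  ultimately show ?thesis
    by (metis add_divide_distrib times_divide_eq_right qint_def)
qed

lemma qint_reflect:
  assumes "q ^ 14 = 1" and "n \<le> 7"
  shows "qint q (7 - n) = - (q ^ 7) * qint q n"
proof -
  have inv: "1 / q ^ m = q ^ (14 - m)" if "m \<le> 14" for m
  proof -
    have "q ^ m * q ^ (14 - m) = 1" using that assms(1) by (simp flip: power_add)
    moreover have "q \<noteq> 0" using assms(1) by auto
    ultimately show ?thesis by (simp add: field_simps)
  qed
  have "q ^ (7 - n) - 1 / q ^ (7 - n) = - (q ^ 7) * (q ^ n - 1 / q ^ n)"
    using assms power_add[of q 14 "7 - n"]
    by (simp add: inv algebra_simps flip: power_add)
  then show ?thesis by (simp add: qint_def)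
qed

lemma qint_values:
  assumes q: "q ^ 14 = 1" "q\<^sup>2 \<noteq> 1" and "qint q 3 \<noteq> 1"
  defines "e \<equiv> - (q ^ 7)" and "\<gamma> \<equiv> qint q 3"
  shows "qint q 2 = e * \<gamma> / (\<gamma> - 1)" and "qint q 4 = e * \<gamma>" and "qint q 5 = \<gamma> / (\<gamma> - 1)"
    and "qint q 6 = e" and "qint q 7 = 0" and "e * e = 1"
proof -
  have q0: "q \<noteq> 0" using q by auto
  note reflect = qint_reflect[OF q(1), folded e_def]
  show e: "e * e = 1" using q by (simp add: e_def flip: power_add)
  show 4: "qint q 4 = e * \<gamma>" using reflect[of 3] by (simp add: \<gamma>_def)
  show 2: "qint q 2 = e * \<gamma> / (\<gamma> - 1)"
    using qint_2_mult_qint_3[OF q0 q(2)] 4 assms(3) by (simp add: \<gamma>_def field_simps)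
  have "qint q 5 = e * (e * \<gamma> / (\<gamma> - 1))"
    using reflect[of 2] by (simp flip: 2)
  then show "qint q 5 = \<gamma> / (\<gamma> - 1)" using e by (simp flip: mult.assoc)
  show "qint q 6 = e" using reflect[of 1] qint_1[OF q0 q(2)] by simp
  show "qint q 7 = 0" using reflect[of 0] by (simp add: qint_def)
qed

lemma qfact_Suc: "qfact q (Suc n) = qfact q n * qint q (Suc n)"
  by (simp add: qfact_def)

lemma qfact_values:
  assumes q: "q ^ 14 = 1" "q\<^sup>2 \<noteq> 1" and r: "r\<^sup>2 = qint q 3" and s: "s\<^sup>2 = qint q 3 - 1" "s \<noteq> 0"
  defines "e \<equiv> - (q ^ 7)"
  shows "qfact q 0 = 1" and "qfact q (Suc 0) = 1"
    and "qfact q 2 = e * r ^ 2 / s ^ 2" and "qfact q 3 = e * r ^ 4 / s ^ 2"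
    and "qfact q 4 = r ^ 6 / s ^ 2" and "qfact q 5 = r ^ 8 / s ^ 4"
    and "qfact q 6 = e * r ^ 8 / s ^ 4" and "qfact q 7 = 0"
proof -
  have q0: "q \<noteq> 0" using q by auto
  have "qint q 3 \<noteq> 1" using s by auto
  moreover have "r\<^sup>2 - 1 = s\<^sup>2" using r s by simp
  ultimately have qint: "qint q 2 = e * r\<^sup>2 / s\<^sup>2" "qint q 4 = e * r\<^sup>2" "qint q 5 = r\<^sup>2 / s\<^sup>2"
      "qint q 6 = e" "qint q 7 = 0" "e * e = 1"
    using qint_values[OF q, folded e_def] by (simp_all flip: r)
  show 0: "qfact q 0 = 1" by (simp add: qfact_def)
  show 1: "qfact q (Suc 0) = 1" using qint_1[OF q0 q(2)] by (simp add: qfact_def)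
  have "qfact q 2 = qfact q (Suc 0) * qint q 2"
    using qfact_Suc[of q "Suc 0"] by (simp only: numeral_2_eq_2)
  then show 2: "qfact q 2 = e * r ^ 2 / s ^ 2"
    by (simp add: 1 qint(1))
  have "qfact q 3 = qfact q 2 * r\<^sup>2"
    using qfact_Suc[of q 2] r by simp
  then show 3: "qfact q 3 = e * r ^ 4 / s ^ 2"
    by (simp add: 2 mult.assoc flip: power_add)
  have "qfact q 4 = qfact q 3 * qint q 4"
    using qfact_Suc[of q 3] by simp
  also have "\<dots> = (e * e) * (r ^ 4 * r\<^sup>2) / s\<^sup>2"
    by (simp add: 3 qint(2))
  finally show 4: "qfact q 4 = r ^ 6 / s ^ 2"
    by (simp add: qint(6) flip: power_add)
  have "qfact q 5 = qfact q 4 * qint q 5"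
    using qfact_Suc[of q 4] by simp
  then show 5: "qfact q 5 = r ^ 8 / s ^ 4"
    by (simp add: 4 qint(3) flip: power_add)
  have "qfact q 6 = qfact q 5 * qint q 6"
    using qfact_Suc[of q 5] by simp
  then show 6: "qfact q 6 = e * r ^ 8 / s ^ 4"
    by (simp add: 5 qint(4))
  have "qfact q 7 = qfact q 6 * qint q 7"
    using qfact_Suc[of q 6] by simp
  then show "qfact q 7 = 0"
    by (simp add: qint(5))
qed

section \<open>The square roots of the radicands\<close>

text \<open>
  The triple is sorted to make the choice depend on the unordered triple only. The explicit cases
  are the admissible triples of even colours; at a triple with an odd colour any square root will do.
\<close>

definition root_choice :: "complex \<Rightarrow> complex \<Rightarrow> complex \<Rightarrow> nat \<Rightarrow> nat \<Rightarrow> nat \<Rightarrow> complex" where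
  "root_choice q r s i j k =
     (let c = sort [i, j, k] in
      if c = [0, 0, 0] then 1 else
      if c = [0, 2, 2] then 1 / r else
      if c = [0, 4, 4] then s / r else
      if c = [2, 2, 2] then s / r ^ 3 else
      if c = [2, 2, 4] then 1 / r ^ 2 else
      if c = [2, 4, 4] then s / r ^ 2 else csqrt (Delta_radicand q i j k))"

lemma Delta_radicand_commute:
  "Delta_radicand q i j k = Delta_radicand q j i k"
  "Delta_radicand q i j k = Delta_radicand q i k j"
  by (simp_all add: Delta_radicand_def ac_simps)

lemma Delta_radicand_sort:
  "\<exists>a b c. sort [i, j, k] = [a, b, c] \<and> Delta_radicand q i j k = Delta_radicand q a b c"
  by (auto simp: Delta_radicand_def ac_simps)

lemma root_choice_commute:
  "root_choice q r s i j k = root_choice q r s j i k"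
  "root_choice q r s i j k = root_choice q r s i k j"
proof -
  have "sort [i, j, k] = sort [j, i, k]" "sort [i, j, k] = sort [i, k, j]"
    by auto
  then show "root_choice q r s i j k = root_choice q r s j i k"
    "root_choice q r s i j k = root_choice q r s i k j"
    unfolding root_choice_def using Delta_radicand_commute by metis+
qed

lemma root_choice_even:
  "root_choice q r s 0 0 0 = 1"
  "root_choice q r s 0 2 2 = 1 / r"
  "root_choice q r s 2 0 2 = 1 / r"
  "root_choice q r s 2 2 0 = 1 / r"
  "root_choice q r s 0 4 4 = s / r"
  "root_choice q r s 4 0 4 = s / r"
  "root_choice q r s 4 4 0 = s / r"
  "root_choice q r s 2 2 2 = s / r ^ 3"
  "root_choice q r s 2 2 4 = 1 / r ^ 2"
  "root_choice q r s 2 4 2 = 1 / r ^ 2"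
  "root_choice q r s 4 2 2 = 1 / r ^ 2"
  "root_choice q r s 2 4 4 = s / r ^ 2"
  "root_choice q r s 4 2 4 = s / r ^ 2"
  "root_choice q r s 4 4 2 = s / r ^ 2"
  by (simp_all add: root_choice_def)

lemma Delta_choice_root_choice:
  assumes q: "q ^ 14 = 1" "q\<^sup>2 \<noteq> 1"
    and r: "r\<^sup>2 = qint q 3" "r \<noteq> 0" and s: "s\<^sup>2 = qint q 3 - 1" "s \<noteq> 0"
  shows "Delta_choice q (root_choice q r s)"
proof -
  define e where "e = - (q ^ 7)"
  note qfact = qfact_values[OF q r(1) s, folded e_def]
  have "e * e = 1" using q by (simp add: e_def flip: power_add)
  then have "e \<noteq> 0" by auto
  have even:
    "Delta_radicand q 0 0 0 = 1" 
    "Delta_radicand q 0 2 2 = (1 / r)\<^sup>2" 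
    "Delta_radicand q 0 4 4 = (s / r)\<^sup>2"
    "Delta_radicand q 2 2 2 = (s / r ^ 3)\<^sup>2"
    "Delta_radicand q 2 2 4 = (1 / r ^ 2)\<^sup>2"
    "Delta_radicand q 2 4 4 = (s / r ^ 2)\<^sup>2"
    using \<open>e * e = 1\<close> \<open>e \<noteq> 0\<close> r(2) s(2)
    by (simp_all add: Delta_radicand_def qfact numeral_2_eq_2[symmetric] numeral_3_eq_3[symmetric])
      (simp_all add: field_simps flip: power_add)
  have "(root_choice q r s i j k)\<^sup>2 = Delta_radicand q i j k" for i j k
  proof -
    obtain a b c where "sort [i, j, k] = [a, b, c]" "Delta_radicand q i j k = Delta_radicand q a b c"
      using Delta_radicand_sort by blast
    then show ?thesis
      unfolding root_choice_def Let_def by (auto simp: even)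
  qed
  then show ?thesis
    unfolding Delta_choice_def using root_choice_commute root_choice_even(1) by blast
qed

section \<open>The listed values\<close>

lemma admissible_iff:
  "admissible x y z \<longleftrightarrow> x + y \<ge> z \<and> y + z \<ge> x \<and> z + x \<ge> y \<and> even (x + y + z) \<and> x + y + z \<le> 10"
  by (auto simp: admissible_def TV7_colours_def)

lemma sum_first: "m \<le> n \<Longrightarrow> sum f {m..n} = f m + sum f {m+1..n::nat}"
  by (simp add: sum.atLeast_Suc_atMost)

lemma TH4_table_values:
  assumes q: "q ^ 14 = 1" "q\<^sup>2 \<noteq> 1"
    and r: "r\<^sup>2 = qint q 3" "r \<noteq> 0" and s: "s\<^sup>2 = qint q 3 - 1" "s \<noteq> 0"
  shows "\<forall>(S, v) \<in> TH4_table (r\<^sup>2) r s. TH4_sixj q (root_choice q r s) S = v"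
proof -
  define e where "e = - (q ^ 7)"
  note qfact = qfact_values[OF q r(1) s, folded e_def]
  have s2: "r\<^sup>2 - 1 = s\<^sup>2" using r s by simp
  have e: "e * e = 1" using q by (simp add: e_def flip: power_add)
  then have e': "e * (e * x) = x" for x by (simp flip: mult.assoc)
  have nz: "e \<noteq> 0" using e by auto
  note evaluate = admissible_iff root_choice_even Let_def sum_first qfact numeral_2_eq_2[symmetric]
      e e' r(2) s(2) nz
  \<comment> \<open>The one entry of the table with two non-zero terms; \<open>r\<^sup>2 - s\<^sup>2 = 1\<close> merges them.\<close>
  have "TH4_sixj q (root_choice q r s) ((1, 1, 1), (1, 1, 1)) = 1 / r ^ 4 - s\<^sup>2 / r ^ 6"
    by (simp add: evaluate; simp add: field_simps r(2) s(2); simp add: eval_nat_numeral)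
  also have "\<dots> = 1 / r ^ 4 - (r\<^sup>2 - 1) / r ^ 6"
    by (simp only: s2)
  also have "\<dots> = 1 / (r\<^sup>2) ^ 3"
    using r(2) by (simp add: divide_simps eval_nat_numeral)
  finally have all_1: "TH4_sixj q (root_choice q r s) ((1, 1, 1), (1, 1, 1)) = 1 / (r\<^sup>2) ^ 3" .
  show ?thesis
    unfolding TH4_table_def s2 ball_simps prod.case all_1
    by (simp add: evaluate; simp add: field_simps e e' r(2) s(2) nz; simp add: eval_nat_numeral)
qed

section \<open>Invariance under the tetrahedral symmetries\<close>

text \<open>
  The Racah sum as a function of the half-sums over the faces and over the quadrilaterals of the
  tetrahedron, in which it is visibly symmetric.
\<close>

definition racah_sum ::
  "complex \<Rightarrow> complex \<Rightarrow> nat \<times> nat \<times> nat \<times> nat \<Rightarrow> nat \<times> nat \<times> nat \<Rightarrow> complex" where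
  "racah_sum q A = (\<lambda>(t1, t2, t3, t4) (u1, u2, u3).
     \<Sum>z = max (max t1 t2) (max t3 t4)..min u1 (min u2 u3). (- 1) ^ z * qfact q (z + 1) * A /
       (qfact q (z - t1) * qfact q (z - t2) * qfact q (z - t3) * qfact q (z - t4) *
        (qfact q (u1 - z) * qfact q (u2 - z) * qfact q (u3 - z))))"

lemma racah_sum_permute:
  "racah_sum q A (t2, t1, t3, t4) u = racah_sum q A (t1, t2, t3, t4) u"
  "racah_sum q A (t1, t3, t2, t4) u = racah_sum q A (t1, t2, t3, t4) u"
  "racah_sum q A (t1, t2, t4, t3) u = racah_sum q A (t1, t2, t3, t4) u"
  "racah_sum q A t (u2, u1, u3) = racah_sum q A t (u1, u2, u3)"
  "racah_sum q A t (u1, u3, u2) = racah_sum q A t (u1, u2, u3)"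
  by (cases t; cases u; simp only: racah_sum_def prod.case max.assoc max.commute max.left_commute
        min.assoc min.commute min.left_commute mult.assoc mult.commute mult.left_commute)+

lemma TV7_sixj_eq_racah_sum:
  "TV7_sixj q D ((i, j, k), (l, m, n)) =
    (if admissible i j k \<and> admissible k l m \<and> admissible m n i \<and> admissible j l n then
       racah_sum q (\<i> ^ (i + j + k + l + m + n) * D i j k * D i m n * D j l n * D k l m)
         ((i + j + k) div 2, (i + m + n) div 2, (j + l + n) div 2, (k + l + m) div 2)
         ((i + j + l + m) div 2, (i + k + l + n) div 2, (j + k + m + n) div 2)
     else 0)"
  unfolding racah_sum_def Let_def TV7_sixj.simps prod.case ..

lemma admissible_commute:
  "admissible j i k \<longleftrightarrow> admissible i j k" "admissible i k j \<longleftrightarrow> admissible i j k"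
  unfolding admissible_def by (auto simp: ac_simps)

text \<open>
  Two neighbouring column transpositions and one exchange of rows generate the other two
  exchanges, so invariance under these three is enough.
\<close>

lemma TV7_sixj_generators:
  assumes "Delta_choice q D"
  shows "TV7_sixj q D ((j, i, k), (m, l, n)) = TV7_sixj q D ((i, j, k), (l, m, n))"
    and "TV7_sixj q D ((i, k, j), (l, n, m)) = TV7_sixj q D ((i, j, k), (l, m, n))"
    and "TV7_sixj q D ((l, m, k), (i, j, n)) = TV7_sixj q D ((i, j, k), (l, m, n))"
proof -
  let ?adm = "admissible i j k \<and> admissible k l m \<and> admissible m n i \<and> admissible j l n"
  have D: "D a c b = D a b c \<and> D b a c = D a b c \<and> D b c a = D a b c \<and>
      D c a b = D a b c \<and> D c b a = D a b c"
    if "admissible a b c" for a b c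
    using assms that admissible_commute unfolding Delta_choice_def by metis
  have adm:
    "(admissible j i k \<and> admissible k m l \<and> admissible l n j \<and> admissible i m n) = ?adm"
    "(admissible i k j \<and> admissible j l n \<and> admissible n m i \<and> admissible k l m) = ?adm"
    "(admissible l m k \<and> admissible k i j \<and> admissible j n l \<and> admissible m i n) = ?adm"
    using admissible_commute by metis+
  have "TV7_sixj q D ((j, i, k), (m, l, n)) = TV7_sixj q D ((i, j, k), (l, m, n)) \<and>
     TV7_sixj q D ((i, k, j), (l, n, m)) = TV7_sixj q D ((i, j, k), (l, m, n)) \<and>
     TV7_sixj q D ((l, m, k), (i, j, n)) = TV7_sixj q D ((i, j, k), (l, m, n))"
  proof (cases ?adm)
    case False
    then show ?thesis unfolding TV7_sixj_eq_racah_sum adm if_not_P[OF False] by simp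
  next
    case True
    then have Ds: "D j i k = D i j k" "D i k j = D i j k" "D k i j = D i j k"
      "D i n m = D i m n" "D m i n = D i m n"
      "D l j n = D j l n" "D l n j = D j l n" "D j n l = D j l n"
      "D k m l = D k l m" "D l m k = D k l m"
      using D[of i j k] D[of k l m] D[of m n i] D[of j l n] by auto
    show ?thesis unfolding TV7_sixj_eq_racah_sum adm if_P[OF True] Ds
      by (intro conjI; simp only: add.assoc add.commute add.left_commute
            mult.assoc mult.commute mult.left_commute; simp only: racah_sum_permute)
  qed
  then show "TV7_sixj q D ((j, i, k), (m, l, n)) = TV7_sixj q D ((i, j, k), (l, m, n))"
    and "TV7_sixj q D ((i, k, j), (l, n, m)) = TV7_sixj q D ((i, j, k), (l, m, n))"
    and "TV7_sixj q D ((l, m, k), (i, j, n)) = TV7_sixj q D ((i, j, k), (l, m, n))"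
    by blast+
qed

lemma TH4_sixj_tetrahedral:
  assumes "tetrahedral S S'" and "Delta_choice q D"
  shows "TH4_sixj q D S' = TH4_sixj q D S"
  using assms(1)
proof induction
  case (exchange13 S i j k l m n)
  have "TV7_sixj q D ((2*l, 2*j, 2*n), (2*i, 2*m, 2*k)) = TV7_sixj q D ((2*i, 2*j, 2*k), (2*l, 2*m, 2*n))"
    using TV7_sixj_generators(2,3)[OF assms(2)] by metis
  then show ?case using exchange13.IH by simp
next
  case (exchange23 S i j k l m n)
  have "TV7_sixj q D ((2*i, 2*m, 2*n), (2*l, 2*j, 2*k)) = TV7_sixj q D ((2*i, 2*j, 2*k), (2*l, 2*m, 2*n))"
    using TV7_sixj_generators[OF assms(2)] by metis
  then show ?case using exchange23.IH by simp
qed (metis TH4_sixj.simps TV7_sixj_generators[OF assms(2)])+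

section \<open>Completeness of the table\<close>

lemma tetrahedral_trans:
  assumes "tetrahedral R S" and "tetrahedral S T"
  shows "tetrahedral R T"
  using assms(2,1) by induction (auto intro: tetrahedral.intros)

text \<open>
  Symbols are compared lexicographically, entry by entry. Minimality under the generators forces
  \<open>i \<le> j \<le> k\<close>, bounds \<open>l\<close> and \<open>m\<close> from below, and breaks ties between equal entries; the
  triangle inequality on the face \<open>(i, j, k)\<close> then leaves six upper rows, and the other three
  faces leave only the listed lower rows.
\<close>

lemma minimal_admissible_in_table:
  assumes adm: "admissible (2*i) (2*j) (2*k)" "admissible (2*k) (2*l) (2*m)"
      "admissible (2*m) (2*n) (2*i)" "admissible (2*j) (2*l) (2*n)"
    and minimal: "((i, j, k), (l, m, n)) \<le> ((j, i, k), (m, l, n))"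
      "((i, j, k), (l, m, n)) \<le> ((i, k, j), (l, n, m))"
      "((i, j, k), (l, m, n)) \<le> ((l, m, k), (i, j, n))"
      "((i, j, k), (l, m, n)) \<le> ((l, j, n), (i, m, k))"
      "((i, j, k), (l, m, n)) \<le> ((i, m, n), (l, j, k))"
  shows "((i, j, k), (l, m, n)) \<in> fst ` TH4_table \<gamma> r s"
proof -
  have face: "x + y \<ge> z \<and> y + z \<ge> x \<and> z + x \<ge> y \<and> x + y + z \<le> 5"
    if "admissible (2*x) (2*y) (2*z)" for x y z
    using that by (auto simp: admissible_def TV7_colours_def)
  have colour: "x \<in> {0, 1, 2} \<and> y \<in> {0, 1, 2} \<and> z \<in> {0, 1, 2}"
    if "admissible (2*x) (2*y) (2*z)" for x y z
    using that by (auto simp: admissible_def TV7_colours_def)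
  have colours: "i \<in> {0, 1, 2}" "j \<in> {0, 1, 2}" "k \<in> {0, 1, 2}"
      "l \<in> {0, 1, 2}" "m \<in> {0, 1, 2}" "n \<in> {0, 1, 2}"
    using adm(1-3)[THEN colour] by (simp_all only:)
  have "i \<le> j" "i = j \<longrightarrow> l \<le> m"
    using minimal(1) by (auto simp: less_eq_prod_simp)
  moreover have "j \<le> k" "j = k \<longrightarrow> m \<le> n"
    using minimal(2) by (auto simp: less_eq_prod_simp)
  moreover have "i \<le> l" "i = l \<longrightarrow> j \<le> m"
    using minimal(3) by (auto simp: less_eq_prod_simp)
  moreover have "i = l \<longrightarrow> k \<le> n"
    using minimal(4) by (auto simp: less_eq_prod_simp)
  moreover have "j \<le> m" "j = m \<longrightarrow> k \<le> n"
    using minimal(5) by (auto simp: less_eq_prod_simp)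
  ultimately have order: "i \<le> j" "j \<le> k" "i \<le> l" "j \<le> m" "i = j \<longrightarrow> l \<le> m" "j = k \<longrightarrow> m \<le> n"
      "j = m \<longrightarrow> k \<le> n" "i = l \<longrightarrow> k \<le> n"
    by simp_all
  consider "i = 0" "j = 0" "k = 0" | "i = 0" "j = 1" "k = 1" | "i = 0" "j = 2" "k = 2"
    | "i = 1" "j = 1" "k = 1" | "i = 1" "j = 1" "k = 2" | "i = 1" "j = 2" "k = 2"
    using colours(1-3) order(1,2) adm(1)[THEN face]
    by (elim insertE emptyE; simp)
  then show ?thesis
    using colours(4-6) order(3-8) adm(2-4)[THEN face]
    by cases (elim insertE emptyE; simp add: TH4_table_def)+
qed

lemma nonzero_in_table_class:
  assumes D: "Delta_choice q D" and nz: "TH4_sixj q D S \<noteq> 0"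
  shows "\<exists>S0 v. (S0, v) \<in> TH4_table \<gamma> r s \<and> tetrahedral S0 S"
proof -
  define S0 where "S0 = (LEAST T. tetrahedral T S)"
  have S0: "tetrahedral S0 S"
    unfolding S0_def by (rule LeastI[of _ S]) (rule tetrahedral.refl)
  have least: "S0 \<le> T" if "tetrahedral T S" for T
    unfolding S0_def using that by (rule Least_le)
  obtain i j k l m n where eq: "S0 = ((i, j, k), (l, m, n))"
    by (metis prod.exhaust)
  have "TH4_sixj q D S0 \<noteq> 0"
    using TH4_sixj_tetrahedral[OF S0 D] nz by simp
  then have adm: "admissible (2*i) (2*j) (2*k)" "admissible (2*k) (2*l) (2*m)"
      "admissible (2*m) (2*n) (2*i)" "admissible (2*j) (2*l) (2*n)"
    unfolding eq TH4_sixj.simps TV7_sixj_eq_racah_sum by (auto split: if_splits)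
  have minimal: "S0 \<le> T" if "tetrahedral T S0" for T
    using that S0 least tetrahedral_trans by blast
  have "S0 \<in> fst ` TH4_table \<gamma> r s"
    unfolding eq
    \<comment> \<open>Each generator is an involution, so it also leads from the image of \<open>S0\<close> back to \<open>S0\<close>.\<close>
    by (intro minimal_admissible_in_table adm minimal[unfolded eq];
        rule tetrahedral.intros(2-)[OF tetrahedral.refl])
  then show ?thesis using S0 by force
qed

section \<open>The invariant of order four\<close>

theorem theorem5:
  fixes \<gamma> q r s :: complex
  assumes "poly poly_T \<gamma> = 0"
    and "q ^ 14 = 1"
    and "primitive_root_of_unity 7 (q\<^sup>2)"
    and "qint q 3 = \<gamma>"
    and "r\<^sup>2 = \<gamma>"
    and "s\<^sup>2 = \<gamma> - 1"
  shows "qint q 3 = q\<^sup>2 + 1 + 1 / q\<^sup>2 \<and>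
    TH4_weight q 0 = 1 \<and>
    TH4_weight q 1 = \<gamma> \<and>
    TH4_weight q 2 = \<gamma> / (\<gamma> - 1) \<and>
    (\<exists>D. Delta_choice q D \<and>
      (\<forall>(S, v) \<in> TH4_table \<gamma> r s. TH4_sixj q D S = v) \<and>
      (\<forall>S \<in> TH4_symbols. \<forall>S'. tetrahedral S S' \<longrightarrow> TH4_sixj q D S' = TH4_sixj q D S) \<and>
      (\<forall>S \<in> TH4_symbols. (\<nexists>S0 v. (S0, v) \<in> TH4_table \<gamma> r s \<and> tetrahedral S0 S) \<longrightarrow>
         TH4_sixj q D S = 0))"
proof -
  have q0: "q \<noteq> 0" using assms(2) by auto
  have "(q\<^sup>2) ^ 1 \<noteq> 1"
    using assms(3) unfolding primitive_root_of_unity_def by fastforce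
  then have q2: "q\<^sup>2 \<noteq> 1" by simp
  have \<gamma>: "\<gamma> \<noteq> 0" "\<gamma> \<noteq> 1"
    using assms(1) by (auto simp: poly_poly_T)
  have r: "r\<^sup>2 = qint q 3" "r \<noteq> 0" and s: "s\<^sup>2 = qint q 3 - 1" "s \<noteq> 0"
    using assms(4-6) \<gamma> by auto
  note D = Delta_choice_root_choice[OF assms(2) q2 r s]
  have "TH4_weight q 0 = 1" "TH4_weight q 1 = \<gamma>" "TH4_weight q 2 = \<gamma> / (\<gamma> - 1)"
    using qint_1[OF q0 q2] qint_values(3)[OF assms(2) q2] assms(4) \<gamma>(2)
    by (simp_all add: TH4_weight_def TV7_weight_def)
  moreover have "\<forall>(S, v) \<in> TH4_table \<gamma> r s. TH4_sixj q (root_choice q r s) S = v"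
    using TH4_table_values[OF assms(2) q2 r s] assms(5) by simp
  ultimately show ?thesis
    using qint_3[OF q0 q2] D TH4_sixj_tetrahedral[OF _ D] nonzero_in_table_class[OF D] by blast
qed

end
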